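(* Let $\mathbf{A}\in\mathbb{R}^{n\times m}$, $\mathbf{y}\in\mathbb{N}^n$, $\bm{\mu}_0\in\mathbb{R}^m$ and $\mathbf{C}_0\in\mathcal{S}_m^+$, and let $$F(\mathbf{\bar{x}},\mathbf{C}) = (\mathbf{y},\mathbf{A}\mathbf{\bar{x}})- (\mathbf{1}_n,e^{\mathbf{A}\mathbf{\bar{x}}+\frac{1}{2}\mathrm{diag}(\mathbf{A}\mathbf{C}\mathbf{A}^t)}) - \tfrac{1}{2}(\mathbf{\bar{x}}-\bm{\mu}_0)^t\mathbf{C}^{-1}_0(\mathbf{\bar{x}}-\bm{\mu}_0) - \tfrac{1}{2}\mathrm{tr}(\mathbf{C}^{-1}_0\mathbf{C})+ \tfrac{1}{2}\ln|\mathbf{C}| - \tfrac{1}{2}\ln|\mathbf{C}_0| + \tfrac{m}{2} - (\mathbf{1}_n,\ln(\mathbf{y}!)).$$ Then there exists a unique pair $(\mathbf{\bar{x}},\mathbf{C})\in\mathbb{R}^m\times\mathcal{S}_m^+$ solving the optimization problem $$\max_{\mathbf{\bar x}\in\mathbb{R}^m,\ \mathbf{C}\in \mathcal{S}_m^+}F(\mathbf{\bar{x}},\mathbf{C}).$$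
   Context: $\mathbb{N}=\{0,1,2,\ldots\}$. $\mathcal{S}_m^+$ is the set of real symmetric positive definite $m\times m$ matrices, $|\cdot|$ is the determinant, the superscript $t$ denotes transpose, and $(\cdot,\cdot)$ is the Euclidean inner product. $\mathbf{1}_n\in\mathbb{R}^n$ is the all-ones vector. Exponential, logarithm and factorial of a vector are taken componentwise. For a square matrix $\mathbf{M}$, $\mathrm{diag}(\mathbf{M})$ is the vector of its diagonal entries. *)

theory Defs
  imports "HOL-Analysis.Analysis"
begin

definition spd_matrices :: "(real^'m^'m) set" where
  "spd_matrices = {M. transpose M = M \<and> (\<forall>v. v \<noteq> 0 \<longrightarrow> v \<bullet> (M *v v) > 0)}"

definition vec_map :: "('a \<Rightarrow> 'b) \<Rightarrow> 'a^'n \<Rightarrow> 'b^'n" where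
  "vec_map f v = (\<chi> i. f (v $ i))"

definition diag_vec :: "'a^'n^'n \<Rightarrow> 'a^'n" where
  "diag_vec M = (\<chi> i. M $ i $ i)"

text \<open>
  The evidence lower bound for a Poisson likelihood with data \<open>y\<close> and design matrix \<open>A\<close>, a
  Gaussian prior with mean \<open>\<mu>\<^sub>0\<close> and covariance \<open>C\<^sub>0\<close>, and a Gaussian variational
  distribution with mean \<open>x\<close> and covariance \<open>C\<close>. Only its values for \<open>C\<^sub>0\<close> and \<open>C\<close> in
  \<open>spd_matrices\<close> are meaningful: elsewhere \<open>matrix_inv\<close> and \<open>ln\<close> may take conventional values.
\<close>

definition elbo ::
  "real^'m^'n \<Rightarrow> nat^'n \<Rightarrow> real^'m \<Rightarrow> real^'m^'m \<Rightarrow> real^'m \<Rightarrow> real^'m^'m \<Rightarrow> real" where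
  "elbo A y \<mu>\<^sub>0 C\<^sub>0 x C =
     vec_map real y \<bullet> (A *v x)
     - (vec 1 :: real^'n) \<bullet> vec_map exp (A *v x + (1/2) *\<^sub>R diag_vec (A ** C ** transpose A))
     - (1/2) * ((x - \<mu>\<^sub>0) \<bullet> (matrix_inv C\<^sub>0 *v (x - \<mu>\<^sub>0)))
     - (1/2) * trace (matrix_inv C\<^sub>0 ** C)
     + (1/2) * ln (det C)
     - (1/2) * ln (det C\<^sub>0)
     + real CARD('m) / 2
     - (vec 1 :: real^'n) \<bullet> vec_map ln (vec_map fact y)"

end

theory Submission
  imports Defs
begin

text \<open>
  Everything rests on the inequality \<open>ln |P| + ln |C| \<le> tr(P C) - m\<close> for positive definite \<open>P\<close>, \<open>C\<close>,
  with equality only if \<open>P C = I\<close>; it follows from the spectral theorem and \<open>ln t \<le> t - 1\<close>.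
  Taking \<open>P\<close> to be the inverse of a midpoint gives strict concavity of \<open>ln |C|\<close>, hence of the
  evidence lower bound, hence uniqueness. Taking \<open>P\<close> to be half the prior precision shows that the
  trace term dominates \<open>ln |C|\<close>; superlevel sets are then bounded and keep \<open>|C|\<close> away from \<open>0\<close>,
  so they lie in a compact set of positive definite matrices and the maximum is attained.
\<close>

section \<open>Spectral theorem for self-adjoint maps on invariant subspaces\<close>

text \<open>If \<open>g v\<close> were nonzero, a small step from \<open>v\<close> in the direction
  \<open>- g v\<close> would make the form negative: its value at \<open>v - t *\<^sub>R g v\<close>
  is \<open>t * (t * k - 2 * a)\<close>, where the linear term dominates.\<close>

lemma semidefinite_null:
  fixes g :: "'a::real_inner \<Rightarrow> 'a"
  assumes "linear g" and adj: "\<And>x y. g x \<bullet> y = x \<bullet> g y"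
    and "subspace S" and nonneg: "\<And>w. w \<in> S \<Longrightarrow> 0 \<le> g w \<bullet> w"
    and "v \<in> S" "g v \<in> S" "g v \<bullet> v = 0"
  shows "g v = 0"
proof (rule ccontr)
  interpret linear g by fact
  assume "g v \<noteq> 0"
  define a where "a = g v \<bullet> g v"
  define k where "k = g (g v) \<bullet> g v"
  have "a > 0" using \<open>g v \<noteq> 0\<close> by (simp add: a_def)
  have "k \<ge> 0" using nonneg assms(6) by (simp add: k_def)
  \<comment> \<open>The summand 1 keeps the denominator positive when \<open>k = 0\<close> and gives
    \<open>t * k \<le> a < 2 * a\<close>.\<close>
  define t where "t = a / (k + 1)"
  have "t > 0" using \<open>a > 0\<close> \<open>k \<ge> 0\<close> by (simp add: t_def)
  have "v - t *\<^sub>R g v \<in> S"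
    using assms by (simp add: subspace_diff subspace_scale)
  hence "0 \<le> g (v - t *\<^sub>R g v) \<bullet> (v - t *\<^sub>R g v)" by (rule nonneg)
  also have "\<dots> = t * (t * k - 2 * a)"
    using assms(7) adj[of "g v" v]
    by (simp add: diff scale inner_diff a_def k_def algebra_simps)
  finally have "0 \<le> t * (t * k - 2 * a)" .
  moreover have "t * k \<le> a"
    using \<open>a > 0\<close> \<open>k \<ge> 0\<close> by (simp add: t_def field_simps)
  hence "t * (t * k - 2 * a) < 0"
    using \<open>a > 0\<close> \<open>t > 0\<close> by (intro mult_pos_neg) auto
  ultimately show False by simp
qed

text \<open>Let \<open>v\<close> maximize the Rayleigh quotient on the unit sphere of
  \<open>S\<close>, with maximum \<open>c\<close>. Then \<open>c *\<^sub>R w - f w\<close> defines a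
  semidefinite form on \<open>S\<close> that vanishes at \<open>v\<close>, so
  \<open>semidefinite_null\<close> makes \<open>v\<close> an eigenvector.\<close>

lemma selfadjoint_eigenvector:
  fixes f :: "'a::euclidean_space \<Rightarrow> 'a"
  assumes "linear f" and adj: "\<And>x y. f x \<bullet> y = x \<bullet> f y"
    and S: "subspace S" "f ` S \<subseteq> S" "S \<noteq> {0}"
  obtains v c where "v \<in> S" "norm v = 1" "f v = c *\<^sub>R v"
proof -
  interpret linear f by fact
  obtain u where u: "u \<in> S" "u \<noteq> 0"
    using S(1,3) subspace_0 by blast
  have "u /\<^sub>R norm u \<in> sphere 0 1 \<inter> S"
    using u S(1) by (simp add: subspace_scale)
  moreover have "compact (sphere 0 1 \<inter> S)"
    using S(1) by (intro compact_Int_closed closed_subspace) auto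
  moreover have "continuous_on (sphere 0 1 \<inter> S) (\<lambda>v. f v \<bullet> v)"
    using assms(1) by (intro continuous_intros linear_continuous_on linear_linear[THEN iffD1]) (simp_all add: linear_conv_bounded_linear)
  ultimately obtain v where v: "v \<in> sphere 0 1 \<inter> S"
    and max: "\<And>w. w \<in> sphere 0 1 \<inter> S \<Longrightarrow> f w \<bullet> w \<le> f v \<bullet> v"
    using continuous_attains_sup[of "sphere 0 1 \<inter> S" "\<lambda>v. f v \<bullet> v"] by blast
  define c where "c = f v \<bullet> v"
  define g where "g = (\<lambda>w. c *\<^sub>R w - f w)"
  have "g v = 0"
  proof (rule semidefinite_null[where g = g and S = S])
    show "linear g"
      unfolding g_def by (intro linear_compose_sub linear_scaleR assms(1))
    show "g x \<bullet> y = x \<bullet> g y" for x y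
      by (simp add: g_def inner_diff adj)
    show "0 \<le> g w \<bullet> w" if "w \<in> S" for w
    proof (cases "w = 0")
      case False
      have "w /\<^sub>R norm w \<in> sphere 0 1 \<inter> S"
        using False that S(1) by (simp add: subspace_scale)
      from max[OF this] have "f w \<bullet> w / (norm w * norm w) \<le> c"
        by (simp add: scale c_def divide_inverse ac_simps)
      thus ?thesis using False
        by (simp add: g_def inner_diff field_simps dot_square_norm power2_eq_square)
    qed simp
    show "v \<in> S" "g v \<in> S"
      using v S by (auto simp: g_def subspace_diff subspace_scale)
    show "g v \<bullet> v = 0"
      using v by (simp add: g_def inner_diff c_def dot_square_norm)
  qed (use S in simp)
  thus ?thesis using that[of v c] v by (auto simp: g_def)
qed

text \<open>Induction on the dimension: split off a unit eigenvector \<open>v\<close>. Its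
  orthogonal complement \<open>T\<close> within \<open>S\<close> is again invariant because
  \<open>f\<close> is self-adjoint. The induction needs arbitrary invariant subspaces, although only
  the whole space is wanted later.\<close>

lemma selfadjoint_orthonormal_eigenbasis:
  fixes f :: "'a::euclidean_space \<Rightarrow> 'a"
  assumes "linear f" and adj: "\<And>x y. f x \<bullet> y = x \<bullet> f y"
    and "subspace S" "f ` S \<subseteq> S"
  shows "\<exists>B. pairwise orthogonal B \<and> (\<forall>b\<in>B. norm b = 1 \<and> (\<exists>c. f b = c *\<^sub>R b)) \<and> span B = S"
  using assms(3,4)
proof (induction "dim S" arbitrary: S rule: less_induct)
  case less
  show ?case
  proof (cases "S = {0}")
    case True
    thus ?thesis by (intro exI[of _ "{}"]) auto
  next
    case False
    obtain v c where v: "v \<in> S" "norm v = 1" "f v = c *\<^sub>R v"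
      using selfadjoint_eigenvector[OF assms(1) adj less.prems False] by blast
    define T where "T = {w \<in> S. v \<bullet> w = 0}"
    have T: "subspace T"
      using less.prems(1) by (auto simp: T_def subspace_def inner_add_right)
    have "f ` T \<subseteq> T"
      using less.prems(2) by (auto simp: T_def v(3) simp flip: adj)
    moreover have "dim T < dim S"
    proof (rule dim_psubset)
      have "v \<notin> T" using v(2) by (auto simp: T_def)
      thus "span T \<subset> span S"
        using T less.prems(1) v(1) by (metis (no_types, lifting) T_def mem_Collect_eq psubsetI span_eq_iff subsetI)
    qed
    ultimately obtain B where B: "pairwise orthogonal B"
      "\<forall>b\<in>B. norm b = 1 \<and> (\<exists>c. f b = c *\<^sub>R b)" "span B = T"
      using less.hyps[OF _ T] by blast
    have "B \<subseteq> T" using B(3) span_superset by blast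
    have "w \<in> span (insert v B)" if "w \<in> S" for w
    proof -
      have "w - (v \<bullet> w) *\<^sub>R v \<in> span B"
        unfolding B(3) using that v less.prems(1)
        by (auto simp: T_def subspace_diff subspace_scale inner_diff_right dot_square_norm)
      thus ?thesis by (auto simp: span_insert)
    qed
    moreover have "span (insert v B) \<subseteq> S"
      using \<open>B \<subseteq> T\<close> v(1) less.prems(1) by (intro span_minimal) (auto simp: T_def)
    ultimately have "span (insert v B) = S" by blast
    moreover have "pairwise orthogonal (insert v B)"
      using B(1) \<open>B \<subseteq> T\<close> by (auto simp: pairwise_insert orthogonal_def T_def inner_commute)
    ultimately show ?thesis
      using B(2) v by (intro exI[of _ "insert v B"]) auto
  qed
qed

section \<open>Orthogonal diagonalization of symmetric matrices\<close>

definition diag_matrix :: "('n \<Rightarrow> 'a::zero) \<Rightarrow> 'a^'n^'n" where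
  "diag_matrix d = (\<chi> i j. if i = j then d i else 0)"

text \<open>The rows of \<open>P\<close> are the orthonormal eigenvectors, enumerated by the index
  type; \<open>P ** M = diag_matrix d ** P\<close> is then the eigenvector equation row by
  row.\<close>

lemma symmetric_matrix_diagonalization:
  fixes M :: "real^'n^'n"
  assumes "transpose M = M"
  obtains P d where "orthogonal_matrix P" "M = transpose P ** diag_matrix d ** P"
proof -
  have adj: "(M *v x) \<bullet> y = x \<bullet> (M *v y)" for x y
    using dot_lmul_matrix[of x M y] assms
    by (simp add: matrix_transpose_mul[symmetric] flip: transpose_matrix_vector)
  obtain B where B: "pairwise orthogonal B" "\<forall>b\<in>B. norm b = 1 \<and> (\<exists>c. M *v b = c *\<^sub>R b)"
      "span B = (UNIV :: (real^'n) set)"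
    using selfadjoint_orthonormal_eigenbasis[of "(*v) M" UNIV] adj by auto
  have "independent B"
    using B(1,2) by (intro pairwise_orthogonal_independent) auto
  hence "finite B" "card B = CARD('n)"
    using B(3) basis_card_eq_dim[of B UNIV] by (auto simp: independent_imp_finite)
  then obtain g where g: "bij_betw g (UNIV::'n set) B"
    using finite_same_card_bij[of "UNIV :: 'n set" B] by auto
  hence gB: "g i \<in> B" for i by (auto simp: bij_betw_def)
  have "\<exists>d. \<forall>i. M *v g i = d i *\<^sub>R g i"
    using B(2) gB by (intro choice) auto
  then obtain d where d: "\<And>i. M *v g i = d i *\<^sub>R g i" by blast
  define P where "P = (\<chi> i. g i)"
  have row: "row i P = g i" for i by (simp add: P_def row_def)
  have ortho: "orthogonal_matrix P"
    unfolding orthogonal_matrix_orthonormal_rows row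
  proof (intro conjI allI impI)
    show "norm (g i) = 1" for i using B(2) gB by auto
    show "orthogonal (g i) (g j)" if "i \<noteq> j" for i j
      using B(1) g that gB by (metis bij_betw_def inj_def pairwise_def)
  qed
  have "P ** M = diag_matrix d ** P"
  proof -
    \<comment> \<open>Row \<open>i\<close> of the product is \<open>g i\<close> multiplied by
      \<open>M\<close> from the right; symmetry turns this into \<open>M *v g i\<close>.\<close>
    have "(P ** M) $ i $ j = (M *v g i) $ j" for i j
    proof -
      have "M $ k $ j = M $ j $ k" for k
        using arg_cong[OF assms, of "\<lambda>N. N $ j $ k"] by (simp add: transpose_def)
      thus ?thesis
        by (simp add: P_def matrix_matrix_mult_def matrix_vector_mult_def mult.commute)
    qed
    thus ?thesis
      by (simp add: vec_eq_iff d diag_matrix_def matrix_matrix_mult_def P_def if_distrib[of "\<lambda>x. x * _"] cong: if_cong)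
  qed
  hence "M = transpose P ** diag_matrix d ** P"
    using ortho by (metis matrix_mul_assoc matrix_mul_lid orthogonal_matrix)
  with ortho show ?thesis by (rule that)
qed

lemma det_diag_matrix: "det (diag_matrix d :: 'a::comm_ring_1^'n^'n) = (\<Prod>i\<in>UNIV. d i)"
  by (subst det_diagonal) (auto simp: diag_matrix_def)

lemma diag_matrix_mult:
  "diag_matrix d ** diag_matrix e = (diag_matrix (\<lambda>i. d i * e i) :: 'a::semiring_1^'n^'n)"
  by (simp add: vec_eq_iff diag_matrix_def matrix_matrix_mult_def if_distrib[of "\<lambda>x. x * _"] cong: if_cong)

lemma transpose_diag_matrix [simp]: "transpose (diag_matrix d) = diag_matrix d"
  by (auto simp: vec_eq_iff diag_matrix_def transpose_def)

section \<open>Congruence, eigenvalues and square roots of positive definite matrices\<close>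

lemma congruence_quadratic_form:
  fixes S :: "real^'m^'n"
  shows "v \<bullet> ((transpose S ** C ** S) *v v) = (S *v v) \<bullet> (C *v (S *v v))"
  by (metis dot_lmul_matrix matrix_vector_mul_assoc transpose_matrix_vector vector_transpose_matrix)

lemma spd_congruence:
  fixes S :: "real^'m^'n"
  assumes "C \<in> spd_matrices" "inj ((*v) S)"
  shows "transpose S ** C ** S \<in> spd_matrices"
proof -
  have "S *v v \<noteq> 0" if "v \<noteq> 0" for v
    using assms(2) that by (metis injD matrix_vector_mult_0_right)
  thus ?thesis using assms(1)
    by (simp add: spd_matrices_def congruence_quadratic_form matrix_transpose_mul matrix_mul_assoc del: transpose_matrix_vector)
qed

lemma spd_diagonalization:
  assumes "M \<in> spd_matrices"
  obtains P d where "orthogonal_matrix P" "M = transpose P ** diag_matrix d ** P" "\<And>i. d i > 0"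
proof -
  obtain P d where P: "orthogonal_matrix P" and M: "M = transpose P ** diag_matrix d ** P"
    using assms symmetric_matrix_diagonalization[of M] by (auto simp: spd_matrices_def)
  have "d i > 0" for i
  proof -
    \<comment> \<open>This is the eigenvector for \<open>d i\<close>; evaluating the form of
      \<open>M\<close> there gives exactly \<open>d i\<close>.\<close>
    define v where "v = transpose P *v axis i 1"
    have Pv: "P *v v = axis i 1"
      using P by (simp add: v_def matrix_vector_mul_assoc orthogonal_matrix_def del: transpose_matrix_vector)
    hence "v \<noteq> 0" by (metis axis_eq_0_iff matrix_vector_mult_0_right zero_neq_one)
    hence "0 < v \<bullet> (M *v v)" using assms by (simp add: spd_matrices_def)
    also have "\<dots> = axis i 1 \<bullet> (diag_matrix d *v axis i 1)"
      unfolding M congruence_quadratic_form Pv ..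
    also have "\<dots> = d i"
      by (simp add: inner_axis' matrix_vector_mult_basis column_def diag_matrix_def)
    finally show ?thesis .
  qed
  with P M show ?thesis by (rule that)
qed

lemma orthogonal_conjugate:
  fixes P :: "real^'n^'n"
  assumes "orthogonal_matrix P"
  shows det_orthogonal_conjugate: "det (transpose P ** D ** P) = det D"
    and trace_orthogonal_conjugate: "trace (transpose P ** D ** P) = trace D"
proof -
  have "P ** transpose P = mat 1" using assms by (simp add: orthogonal_matrix_def)
  thus "trace (transpose P ** D ** P) = trace D"
    by (metis matrix_mul_assoc matrix_mul_lid trace_mul_sym)
  from \<open>P ** transpose P = mat 1\<close> have "det P * det P = 1"
    by (metis det_I det_mul det_transpose)
  thus "det (transpose P ** D ** P) = det D" by (simp add: det_mul)
qed

lemma det_spd_pos: "M \<in> spd_matrices \<Longrightarrow> det M > 0"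
  by (erule spd_diagonalization) (simp add: det_orthogonal_conjugate det_diag_matrix prod_pos)

text \<open>Take square roots of the eigenvalues in the same eigenbasis. The root is wanted because
  a product of two positive definite matrices need not be symmetric, whereas a congruence by the
  root is.\<close>

lemma spd_sqrt:
  assumes "M \<in> spd_matrices"
  obtains S where "transpose S = S" "S ** S = M" "invertible S"
proof -
  obtain P d where P: "orthogonal_matrix P" and M: "M = transpose P ** diag_matrix d ** P"
    and d: "\<And>i. d i > 0"
    using assms spd_diagonalization by blast
  define S where "S = transpose P ** diag_matrix (\<lambda>i. sqrt (d i)) ** P"
  have "S ** S = transpose P ** diag_matrix (\<lambda>i. sqrt (d i)) ** (P ** transpose P) ** diag_matrix (\<lambda>i. sqrt (d i)) ** P"
    by (simp add: S_def matrix_mul_assoc)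
  also have "\<dots> = transpose P ** (diag_matrix (\<lambda>i. sqrt (d i)) ** diag_matrix (\<lambda>i. sqrt (d i))) ** P"
    using P by (simp add: orthogonal_matrix_def matrix_mul_assoc)
  also have "\<dots> = M"
    using d by (simp add: diag_matrix_mult M less_imp_le)
  finally have "S ** S = M" .
  moreover have "transpose S = S"
    by (simp add: S_def matrix_transpose_mul matrix_mul_assoc)
  moreover have "det S \<noteq> 0"
    using det_spd_pos[OF assms] \<open>S ** S = M\<close> by (metis det_mul less_irrefl mult_zero_left)
  ultimately show ?thesis using that by (simp add: invertible_det_nz)
qed

section \<open>The inequality between log-determinant and trace\<close>

text \<open>In terms of the eigenvalues the gap is the sum of \<open>d i - 1 - ln (d i)\<close>.
  Every summand is nonnegative and vanishes only for \<open>d i = 1\<close>.\<close>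

lemma
  fixes M :: "real^'n^'n"
  assumes "M \<in> spd_matrices"
  shows ln_det_le_trace: "ln (det M) \<le> trace M - CARD('n)"
    and ln_det_eq_trace: "ln (det M) = trace M - CARD('n) \<Longrightarrow> M = mat 1"
proof -
  obtain P d where P: "orthogonal_matrix P" and M: "M = transpose P ** diag_matrix d ** P"
    and d: "\<And>i. d i > 0"
    using assms spd_diagonalization by blast
  have eq: "trace M - CARD('n) - ln (det M) = (\<Sum>i\<in>UNIV. d i - 1 - ln (d i))"
    unfolding M orthogonal_conjugate[OF P] det_diag_matrix using d
    by (simp add: ln_prod trace_def diag_matrix_def sum_subtractf less_imp_neq[THEN not_sym])
  have nonneg: "0 \<le> d i - 1 - ln (d i)" for i
    using ln_le_minus_one[OF d[of i]] by simp
  show "ln (det M) \<le> trace M - CARD('n)"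
    using eq sum_nonneg[of UNIV "\<lambda>i. d i - 1 - ln (d i)"] nonneg by simp
  assume "ln (det M) = trace M - CARD('n)"
  hence "d i - 1 - ln (d i) = 0" for i
    using eq sum_nonneg_eq_0_iff[of UNIV "\<lambda>i. d i - 1 - ln (d i)"] nonneg by auto
  hence "d i = 1" for i
    using ln_eq_minus_one[OF d[of i]] by simp
  hence "diag_matrix d = mat 1"
    by (simp add: diag_matrix_def mat_def cong: if_cong)
  thus "M = mat 1" using P by (simp add: M orthogonal_matrix_def)
qed

text \<open>With \<open>S\<close> the square root of \<open>P\<close>, everything reduces to \<open>S C S\<close>.\<close>
lemma
  fixes P C :: "real^'n^'n"
  assumes "P \<in> spd_matrices" "C \<in> spd_matrices"
  shows ln_det_add_le_trace: "ln (det P) + ln (det C) \<le> trace (P ** C) - CARD('n)"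
    and ln_det_add_eq_trace: "ln (det P) + ln (det C) = trace (P ** C) - CARD('n) \<Longrightarrow> P ** C = mat 1"
    and trace_spd_mult_pos: "trace (P ** C) > 0"
proof -
  obtain S where S: "transpose S = S" "S ** S = P" "invertible S"
    using spd_sqrt[OF assms(1)] .
  define M where "M = S ** C ** S"
  have M: "M \<in> spd_matrices"
    using spd_congruence[OF assms(2), of S] S(1,3)
    by (simp add: M_def inj_matrix_vector_mult)
  have "det M = det P * det C"
    unfolding S(2)[symmetric] by (simp add: M_def det_mul)
  hence det: "ln (det M) = ln (det P) + ln (det C)"
    using assms by (simp add: ln_mult_pos det_spd_pos)
  have tr: "trace M = trace (P ** C)"
    unfolding S(2)[symmetric] by (simp add: M_def trace_mul_sym[of _ S] matrix_mul_assoc)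
  show "ln (det P) + ln (det C) \<le> trace (P ** C) - CARD('n)"
    using ln_det_le_trace[OF M] by (simp add: det tr)
  have "M $ i $ i > 0" for i
  proof -
    have "0 < axis i 1 \<bullet> (M *v axis i 1)" using M by (simp add: spd_matrices_def axis_eq_0_iff)
    thus ?thesis by (simp add: inner_axis' matrix_vector_mult_basis column_def)
  qed
  hence "trace M > 0" by (auto simp: trace_def intro!: sum_pos)
  thus "trace (P ** C) > 0" by (simp add: tr)
  assume "ln (det P) + ln (det C) = trace (P ** C) - CARD('n)"
  hence "M = mat 1"
    using ln_det_eq_trace[OF M] by (simp add: det tr)
  \<comment> \<open>One-sided inverses of square matrices are two-sided, so \<open>S\<close> can be
    moved cyclically to the other end of the product.\<close>
  hence "S ** (C ** S) = mat 1"
    by (simp add: M_def matrix_mul_assoc)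
  hence "(C ** S) ** S = mat 1" by (simp add: matrix_left_right_inverse)
  hence "C ** P = mat 1" by (simp add: S(2) flip: matrix_mul_assoc)
  thus "P ** C = mat 1" by (simp add: matrix_left_right_inverse)
qed

section \<open>Closure properties, inverses and strict concavity of the log-determinant\<close>

lemma spd_scaleR: "M \<in> spd_matrices \<Longrightarrow> c > 0 \<Longrightarrow> c *\<^sub>R M \<in> spd_matrices"
  by (simp add: spd_matrices_def transpose_scalar flip: scaleR_matrix_vector_assoc)

lemma spd_add: "M \<in> spd_matrices \<Longrightarrow> N \<in> spd_matrices \<Longrightarrow> M + N \<in> spd_matrices"
  by (simp add: spd_matrices_def transpose_def vec_eq_iff matrix_vector_mult_add_rdistrib inner_add_right add_pos_pos)

lemma spd_nonneg: "M \<in> spd_matrices \<Longrightarrow> 0 \<le> v \<bullet> (M *v v)"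
  by (cases "v = 0") (auto simp: spd_matrices_def less_imp_le)

lemma
  assumes "M \<in> spd_matrices"
  shows matrix_inv_spd: "matrix_inv M \<in> spd_matrices"
    and matrix_inv_spd_left: "matrix_inv M ** M = mat 1"
proof -
  have "invertible M"
    using det_spd_pos[OF assms] by (simp add: invertible_det_nz)
  hence "M ** matrix_inv M = mat 1 \<and> matrix_inv M ** M = mat 1"
    unfolding invertible_def matrix_inv_def by (rule someI_ex)
  hence inv: "matrix_inv M ** M = mat 1" "M ** matrix_inv M = mat 1" by auto
  show "matrix_inv M ** M = mat 1" by (rule inv)
  have "inj ((*v) (matrix_inv M))"
    using inv matrix_left_invertible_injective by blast
  \<comment> \<open>This congruence collapses to \<open>transpose (matrix_inv M)\<close>, so
    symmetry and definiteness of the inverse come out together.\<close>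
  hence "transpose (matrix_inv M) ** M ** matrix_inv M \<in> spd_matrices"
    by (intro spd_congruence assms)
  hence "transpose (matrix_inv M) \<in> spd_matrices"
    by (simp add: inv flip: matrix_mul_assoc)
  moreover from this have "transpose (matrix_inv M) = matrix_inv M"
    by (simp add: spd_matrices_def)
  ultimately show "matrix_inv M \<in> spd_matrices" by simp
qed

lemma ln_det_matrix_inv:
  assumes "M \<in> spd_matrices"
  shows "ln (det (matrix_inv M)) = - ln (det M)"
proof -
  have "det (matrix_inv M) * det M = 1"
    by (metis assms det_I det_mul matrix_inv_spd_left)
  hence "det (matrix_inv M) = inverse (det M)"
    by (metis inverse_unique mult.commute)
  thus ?thesis by (simp add: ln_inverse det_spd_pos[OF assms])
qed

lemma trace_scaleR: "trace (c *\<^sub>R M) = c * trace (M :: real^'n^'n)"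
  by (simp add: trace_def sum_distrib_left)

text \<open>With \<open>P\<close> the inverse of the midpoint, the traces of \<open>P ** C\<close>
  and \<open>P ** D\<close> add up to twice the dimension. Adding the trace inequality for the pairs
  \<open>P\<close>, \<open>C\<close> and \<open>P\<close>, \<open>D\<close> therefore cancels
  everything except the log-determinants.\<close>

lemma ln_det_midpoint_concave:
  fixes C D :: "real^'n^'n"
  assumes C: "C \<in> spd_matrices" and D: "D \<in> spd_matrices"
  defines "M \<equiv> (1/2) *\<^sub>R (C + D)"
  shows "ln (det C) + ln (det D) \<le> 2 * ln (det M)"
    and "C \<noteq> D \<Longrightarrow> ln (det C) + ln (det D) < 2 * ln (det M)"
proof -
  define P where "P = matrix_inv M"
  have M: "M \<in> spd_matrices"
    using assms by (simp add: spd_scaleR spd_add)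
  note P = matrix_inv_spd[OF M, folded P_def]
  have "trace (P ** C) + trace (P ** D) = trace (P ** (2 *\<^sub>R M))"
    by (simp add: M_def matrix_add_ldistrib trace_add)
  also have "\<dots> = 2 * trace (P ** M)"
    by (simp add: matrix_scalar_ac trace_scaleR flip: scalar_matrix_assoc)
  also have "\<dots> = 2 * CARD('n)"
    unfolding P_def matrix_inv_spd_left[OF M] trace_I by simp
  finally have tr: "trace (P ** C) + trace (P ** D) = 2 * CARD('n)" .
  note ln = ln_det_matrix_inv[OF M, folded P_def]
  note le = ln_det_add_le_trace[OF P C] ln_det_add_le_trace[OF P D]
  show "ln (det C) + ln (det D) \<le> 2 * ln (det M)"
    using le tr ln by linarith
  show "ln (det C) + ln (det D) < 2 * ln (det M)" if "C \<noteq> D"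
  proof (rule ccontr)
    assume "\<not> ?thesis"
    \<comment> \<open>Without strictness both trace inequalities are equalities, so \<open>C\<close>
      and \<open>D\<close> are both inverse to \<open>P\<close>.\<close>
    hence "P ** C = mat 1" "P ** D = mat 1"
      using le tr ln by (auto intro!: ln_det_add_eq_trace P C D)
    hence "C = D"
      by (metis matrix_left_right_inverse matrix_mul_assoc matrix_mul_lid matrix_mul_rid)
    thus False using that by simp
  qed
qed

section \<open>Coercivity, norm bounds and semidefinite limits\<close>

lemma matrix_sub_rdistrib: "(A - B) ** C = A ** C - B ** (C :: 'a::ring_1^'n^'m)"
  by (simp add: matrix_matrix_mult_def vec_eq_iff left_diff_distrib sum_subtractf)

text \<open>By compactness the form has a positive minimum on the unit sphere. The trace bound is
  \<open>trace_spd_mult_pos\<close> applied to \<open>P - l *\<^sub>R mat 1\<close>.\<close>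

lemma spd_coercive:
  fixes P :: "real^'n^'n"
  assumes "P \<in> spd_matrices"
  obtains l where "l > 0" "\<And>v. l * (v \<bullet> v) \<le> v \<bullet> (P *v v)"
    "\<And>C. C \<in> spd_matrices \<Longrightarrow> l * trace C \<le> trace (P ** C)"
proof -
  \<comment> \<open>Here \<open>undefined\<close> just names some index, to show that the sphere is
    nonempty.\<close>
  have "axis (undefined :: 'n) 1 \<in> sphere (0 :: real^'n) 1" by simp
  hence "sphere (0 :: real^'n) 1 \<noteq> {}" by blast
  moreover have "continuous_on (sphere 0 1) (\<lambda>v. v \<bullet> (P *v v))"
    by (intro continuous_intros matrix_vector_mult_linear_continuous_on)
  ultimately obtain u where u: "u \<in> sphere 0 1"
    and min: "\<And>v. v \<in> sphere 0 1 \<Longrightarrow> u \<bullet> (P *v u) \<le> v \<bullet> (P *v v)"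
    using continuous_attains_inf[of "sphere 0 1" "\<lambda>v. v \<bullet> (P *v v)"] by auto
  define c where "c = u \<bullet> (P *v u)"
  have "u \<noteq> 0" using u by auto
  hence "c > 0" using assms by (simp add: c_def spd_matrices_def)
  have c: "c * (v \<bullet> v) \<le> v \<bullet> (P *v v)" for v
  proof (cases "v = 0")
    case False
    hence "c \<le> (v /\<^sub>R norm v) \<bullet> (P *v (v /\<^sub>R norm v))"
      unfolding c_def by (intro min) simp
    also have "\<dots> = v \<bullet> (P *v v) / (v \<bullet> v)"
      by (simp add: matrix_vector_mult_scaleR dot_square_norm power2_eq_square field_simps)
    finally show ?thesis using False by (simp add: field_simps)
  qed simp
  \<comment> \<open>Half the minimum, so that \<open>P - l *\<^sub>R mat 1\<close> is still strictly
    definite.\<close>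
  define l where "l = c / 2"
  have "l > 0" using \<open>c > 0\<close> by (simp add: l_def)
  have less: "l * (v \<bullet> v) < v \<bullet> (P *v v)" if "v \<noteq> 0" for v
  proof -
    have "v \<bullet> v > 0" using that by simp
    hence "l * (v \<bullet> v) < c * (v \<bullet> v)" using \<open>c > 0\<close> by (simp add: l_def)
    thus ?thesis using c[of v] by linarith
  qed
  have "transpose (l *\<^sub>R mat 1) = l *\<^sub>R (mat 1 :: real^'n^'n)"
    by (simp add: transpose_scalar)
  hence "P - l *\<^sub>R mat 1 \<in> spd_matrices"
    using assms less
    by (simp add: spd_matrices_def matrix_vector_mult_diff_rdistrib inner_diff_right transpose_def vec_eq_iff flip: scaleR_matrix_vector_assoc)
  hence "0 \<le> trace ((P - l *\<^sub>R mat 1) ** C)" if "C \<in> spd_matrices" for C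
    using that by (intro less_imp_le trace_spd_mult_pos)
  moreover have "trace ((P - l *\<^sub>R mat 1) ** C) = trace (P ** C) - l * trace C" for C
    by (simp add: matrix_sub_rdistrib trace_sub trace_scaleR flip: scalar_matrix_assoc)
  ultimately show ?thesis
    using that[of l] \<open>l > 0\<close> less by (metis diff_ge_0_iff_ge inner_zero_left less_imp_le mult_zero_right order_refl)
qed

text \<open>Testing the form on sums and differences of two axis vectors bounds each off-diagonal
  entry by the mean of two diagonal ones. The factor counts the entries; it is crude but enough for
  boundedness.\<close>

lemma norm_le_trace_spd:
  fixes C :: "real^'n^'n"
  assumes "C \<in> spd_matrices"
  shows "norm C \<le> (CARD('n))\<^sup>2 * trace C"
proof -
  have entry: "axis i 1 \<bullet> (C *v axis j 1) = C $ i $ j" for i j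
    by (simp add: inner_axis' matrix_vector_mult_basis column_def)
  have diag: "0 \<le> C $ i $ i" for i
    using spd_nonneg[OF assms, of "axis i 1"] by (simp add: entry)
  have le: "C $ i $ i \<le> trace C" for i
    unfolding trace_def by (rule member_le_sum) (use diag in auto)
  have sym: "C $ i $ j = C $ j $ i" for i j
    using assms by (auto simp: spd_matrices_def transpose_def vec_eq_iff)
  have "\<bar>C $ i $ j\<bar> \<le> trace C" for i j
  proof -
    have "0 \<le> C $ i $ i + C $ j $ j + 2 * C $ i $ j"
      using spd_nonneg[OF assms, of "axis i 1 + axis j 1"]
      by (simp add: matrix_vector_right_distrib inner_add_left inner_add_right entry sym[of j i])
    moreover have "0 \<le> C $ i $ i + C $ j $ j - 2 * C $ i $ j"
      using spd_nonneg[OF assms, of "axis i 1 - axis j 1"]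
      by (simp add: matrix_vector_mult_diff_distrib inner_diff_left inner_diff_right entry sym[of j i])
    ultimately show ?thesis using le[of i] le[of j] by linarith
  qed
  hence "norm (C $ i) \<le> CARD('n) * trace C" for i
    using norm_le_l1_cart[of "C $ i"] sum_bounded_above[of UNIV "\<lambda>j. \<bar>C $ i $ j\<bar>" "trace C"] by fastforce
  hence "(\<Sum>i\<in>UNIV. norm (C $ i)) \<le> (\<Sum>i\<in>(UNIV::'n set). CARD('n) * trace C)"
    by (intro sum_mono)
  moreover have "norm C \<le> (\<Sum>i\<in>UNIV. norm (C $ i))"
    unfolding norm_vec_def by (rule L2_set_le_sum) simp
  ultimately show ?thesis by (simp add: power2_eq_square)
qed

text \<open>Recovers strict definiteness from conditions that survive limits: where the form
  vanishes, \<open>semidefinite_null\<close> gives a kernel vector, and invertibility makes it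
  zero.\<close>

lemma spd_if_semidefinite:
  assumes "transpose C = C" "\<And>v. 0 \<le> v \<bullet> (C *v v)" "det C \<noteq> 0"
  shows "C \<in> spd_matrices"
proof -
  have "v = 0" if "v \<bullet> (C *v v) = 0" for v
  proof -
    have "C *v v = 0"
    proof (rule semidefinite_null[where g = "(*v) C" and S = UNIV])
      show "(C *v x) \<bullet> y = x \<bullet> (C *v y)" for x y
        by (metis assms(1) dot_lmul_matrix transpose_matrix_vector)
    qed (use assms(2) that in \<open>auto simp: inner_commute\<close>)
    thus ?thesis
      using assms(3) by (metis invertible_det_nz inj_matrix_vector_mult injD matrix_vector_mult_0_right)
  qed
  thus ?thesis using assms(1,2) by (auto simp: spd_matrices_def less_le)
qed

section \<open>Strict midpoint concavity of the evidence lower bound\<close>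

text \<open>The diagonal of \<open>A ** C ** transpose A\<close> consists of the values of the form
  of \<open>C\<close> at the rows of \<open>A\<close>. The last bracket collects what is independent
  of \<open>x\<close> and \<open>C\<close>.\<close>

lemma elbo_eq:
  fixes A :: "real^'m^'n"
  shows "elbo A y \<mu> C\<^sub>0 x C =
     (\<Sum>i\<in>UNIV. real (y $ i) * (A $ i \<bullet> x) - exp (A $ i \<bullet> x + (A $ i \<bullet> (C *v A $ i)) / 2))
     - ((x - \<mu>) \<bullet> (matrix_inv C\<^sub>0 *v (x - \<mu>))) / 2
     - trace (matrix_inv C\<^sub>0 ** C) / 2 + ln (det C) / 2
     - (ln (det C\<^sub>0) / 2 - real CARD('m) / 2 + (\<Sum>i\<in>UNIV. ln (fact (y $ i))))"
proof -
  have "(A ** C ** transpose A) $ i $ i = A $ i \<bullet> (C *v A $ i)" for i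
    unfolding matrix_mul_assoc[symmetric]
    by (simp add: matrix_matrix_mult_def matrix_vector_mult_def transpose_def inner_vec_def)
  thus ?thesis
    by (simp add: elbo_def vec_map_def diag_vec_def inner_vec_def[of "vec_lambda _"] inner_vec_def[of 1] matrix_vector_mul_component
        sum_subtractf)
qed

lemma exp_midpoint_le: "2 * exp ((a + b) / 2) \<le> exp a + exp (b::real)"
proof -
  have "0 \<le> (exp (a/2) - exp (b/2))\<^sup>2" by simp
  also have "\<dots> = exp a + exp b - 2 * exp ((a + b) / 2)"
    by (simp add: power2_diff add_divide_distrib exp_add flip: exp_double)
  finally show ?thesis by simp
qed

text \<open>A parallelogram law; its explicit defect in \<open>u - w\<close> is what yields
  strictness in the mean.\<close>

lemma quadratic_form_midpoint:
  fixes P :: "real^'n^'n"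
  assumes "transpose P = P"
  shows "2 * (((1/2) *\<^sub>R (u + w)) \<bullet> (P *v ((1/2) *\<^sub>R (u + w))))
    = u \<bullet> (P *v u) + w \<bullet> (P *v w) - (u - w) \<bullet> (P *v (u - w)) / 2"
proof -
  have "w \<bullet> (P *v u) = u \<bullet> (P *v w)"
    by (metis assms dot_lmul_matrix inner_commute transpose_matrix_vector)
  thus ?thesis
    by (simp add: matrix_vector_mult_scaleR matrix_vector_right_distrib matrix_vector_mult_diff_distrib
        inner_add_left inner_add_right inner_diff_left inner_diff_right field_simps)
qed

text \<open>The exponents are affine jointly in mean and covariance, so the data term is concave;
  the trace term is linear. Strictness comes from the quadratic defect if
  \<open>x \<noteq> z\<close> and from the log-determinant if \<open>C \<noteq> D\<close>.\<close>

lemma elbo_midpoint: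
  fixes A :: "real^'m^'n"
  assumes C\<^sub>0: "C\<^sub>0 \<in> spd_matrices" and C: "C \<in> spd_matrices" and D: "D \<in> spd_matrices"
    and neq: "(x, C) \<noteq> (z, D)"
  shows "elbo A y \<mu> C\<^sub>0 x C + elbo A y \<mu> C\<^sub>0 z D
    < 2 * elbo A y \<mu> C\<^sub>0 ((1/2) *\<^sub>R (x + z)) ((1/2) *\<^sub>R (C + D))"
proof -
  define P where "P = matrix_inv C\<^sub>0"
  define q where "q = (\<lambda>v. v \<bullet> (P *v v))"
  define a where "a = (\<lambda>x C i. A $ i \<bullet> x + (A $ i \<bullet> (C *v A $ i)) / 2)"
  define l where "l = (\<lambda>x C. \<Sum>i\<in>UNIV. real (y $ i) * (A $ i \<bullet> x) - exp (a x C i))"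
  define k where "k = ln (det C\<^sub>0) / 2 - real CARD('m) / 2 + (\<Sum>i\<in>UNIV. ln (fact (y $ i)))"
  have elbo: "elbo A y \<mu> C\<^sub>0 w M = l w M - q (w - \<mu>) / 2 - trace (P ** M) / 2 + ln (det M) / 2 - k" for w M
    unfolding elbo_eq by (simp add: l_def a_def q_def P_def k_def)
  let ?x = "(1/2) *\<^sub>R (x + z)" and ?C = "(1/2) *\<^sub>R (C + D)"
  note P = matrix_inv_spd[OF C\<^sub>0, folded P_def]
  have mid: "a ?x ?C i = (a x C i + a z D i) / 2" for i
    by (simp add: a_def inner_add_right matrix_vector_mult_add_rdistrib field_simps flip: scaleR_matrix_vector_assoc)
  have "l x C + l z D \<le> 2 * l ?x ?C"
    unfolding l_def sum.distrib[symmetric] sum_distrib_left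
  proof (rule sum_mono)
    fix i
    show "real (y $ i) * (A $ i \<bullet> x) - exp (a x C i) + (real (y $ i) * (A $ i \<bullet> z) - exp (a z D i))
      \<le> 2 * (real (y $ i) * (A $ i \<bullet> ?x) - exp (a ?x ?C i))"
      using exp_midpoint_le[of "a x C i" "a z D i"]
      unfolding mid inner_scaleR_right inner_add_right by (simp add: algebra_simps)
  qed
  moreover have "2 * q (?x - \<mu>) = q (x - \<mu>) + q (z - \<mu>) - q (x - z) / 2"
  proof -
    have "?x - \<mu> = (1/2) *\<^sub>R ((x - \<mu>) + (z - \<mu>))"
      by (simp add: vec_eq_iff field_simps)
    thus ?thesis
      using quadratic_form_midpoint[of P "x - \<mu>" "z - \<mu>"] P by (simp add: q_def spd_matrices_def)
  qed
  moreover have "2 * trace (P ** ?C) = trace (P ** C) + trace (P ** D)"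
    by (simp add: matrix_add_ldistrib trace_add matrix_scalar_ac trace_scaleR flip: scalar_matrix_assoc)
  moreover note ln_det_midpoint_concave[OF C D]
  moreover have "q (x - z) \<ge> 0" "x \<noteq> z \<Longrightarrow> q (x - z) > 0"
    using P spd_nonneg[OF P] by (auto simp: q_def spd_matrices_def)
  moreover have "x \<noteq> z \<or> C \<noteq> D" using neq by auto
  ultimately show ?thesis
    unfolding elbo by argo
qed

section \<open>Upper bounds on the evidence lower bound\<close>

text \<open>As a function of \<open>a\<close> the left side peaks at \<open>a = ln k\<close>. For
  \<open>k = 0\<close> the factor 0 absorbs \<open>ln 0\<close> and the claim is
  \<open>- exp a \<le> 0\<close>.\<close>

lemma poisson_loglik_le: "real k * a - exp a \<le> real k * ln (real k) - real k"
proof (cases "k = 0")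
  case False
  have "1 + (a - ln (real k)) \<le> exp (a - ln (real k))" by (rule exp_ge_add_one_self)
  also have "\<dots> = exp a / real k" using False by (simp add: exp_diff)
  finally show ?thesis using False by (simp add: field_simps)
qed simp

text \<open>On a superlevel set the first bound confines mean and covariance, and the second keeps
  the determinant away from 0.\<close>

lemma elbo_upper_bounds:
  fixes A :: "real^'m^'n"
  assumes C\<^sub>0: "C\<^sub>0 \<in> spd_matrices"
  obtains b K where "b > 0"
    "\<And>x C. C \<in> spd_matrices \<Longrightarrow> elbo A y \<mu> C\<^sub>0 x C \<le> K - b * (norm (x - \<mu>))\<^sup>2 - b * trace C"
    "\<And>x C. C \<in> spd_matrices \<Longrightarrow> elbo A y \<mu> C\<^sub>0 x C \<le> K + ln (det C) / 2"
proof -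
  define P where "P = matrix_inv C\<^sub>0"
  note P = matrix_inv_spd[OF C\<^sub>0, folded P_def]
  obtain c where c: "c > 0" "\<And>v. c * (v \<bullet> v) \<le> v \<bullet> (P *v v)"
    "\<And>C. C \<in> spd_matrices \<Longrightarrow> c * trace C \<le> trace (P ** C)"
    using spd_coercive[OF P] by metis
  define L where "L = (\<Sum>i\<in>UNIV. real (y $ i) * ln (real (y $ i)) - real (y $ i))
    - (ln (det C\<^sub>0) / 2 - real CARD('m) / 2 + (\<Sum>i\<in>UNIV. ln (fact (y $ i))))"
  \<comment> \<open>The constant left by the trace inequality for \<open>(1/2) *\<^sub>R P\<close>
    and \<open>C\<close>; the halving leaves part of the trace penalty unspent.\<close>
  define J where "J = - CARD('m) - ln (det ((1/2) *\<^sub>R P))"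
  \<comment> \<open>Absorbing \<open>ln (det C) / 2\<close> uses up a quarter of
    \<open>trace (P ** C)\<close>; the remaining quarter is at least \<open>c / 4\<close> times
    \<open>trace C\<close>.\<close>
  define b where "b = c / 4"
  have bound: "elbo A y \<mu> C\<^sub>0 x C \<le> L - c * (norm (x - \<mu>))\<^sup>2 / 2 - trace (P ** C) / 2 + ln (det C) / 2"
    if "C \<in> spd_matrices" for x C
  proof -
    have "(\<Sum>i\<in>UNIV. real (y $ i) * (A $ i \<bullet> x) - exp (A $ i \<bullet> x + (A $ i \<bullet> (C *v A $ i)) / 2))
      \<le> (\<Sum>i\<in>UNIV. real (y $ i) * ln (real (y $ i)) - real (y $ i))"
    proof (rule sum_mono)
      fix i
      \<comment> \<open>The covariance only enlarges the exponential, so dropping it bounds the data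
        term from above.\<close>
      have "exp (A $ i \<bullet> x) \<le> exp (A $ i \<bullet> x + (A $ i \<bullet> (C *v A $ i)) / 2)"
        using spd_nonneg[OF that] by simp
      thus "real (y $ i) * (A $ i \<bullet> x) - exp (A $ i \<bullet> x + (A $ i \<bullet> (C *v A $ i)) / 2)
        \<le> real (y $ i) * ln (real (y $ i)) - real (y $ i)"
        using poisson_loglik_le[of "y $ i" "A $ i \<bullet> x"] by linarith
    qed
    thus ?thesis
      using c(2)[of "x - \<mu>"] unfolding elbo_eq P_def[symmetric] L_def power2_norm_eq_inner
      by linarith
  qed
  have ln_det: "ln (det C) \<le> trace (P ** C) / 2 + J" if "C \<in> spd_matrices" for C
    using ln_det_add_le_trace[OF spd_scaleR[OF P, of "1/2"] that]
    by (simp add: J_def trace_scaleR flip: scalar_matrix_assoc)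
  show ?thesis
  proof (rule that[of b "max L (L + J / 2)"])
    show "b > 0" using c(1) by (simp add: b_def)
    fix x C assume C: "C \<in> (spd_matrices :: (real^'m^'m) set)"
    have "0 \<le> c * (norm (x - \<mu>))\<^sup>2" using c(1) by simp
    hence "elbo A y \<mu> C\<^sub>0 x C \<le> (L + J / 2) - b * (norm (x - \<mu>))\<^sup>2 - b * trace C"
      using bound[OF C, of x] ln_det[OF C] c(3)[OF C] unfolding b_def by (simp add: field_simps)
    thus "elbo A y \<mu> C\<^sub>0 x C \<le> max L (L + J / 2) - b * (norm (x - \<mu>))\<^sup>2 - b * trace C"
      by linarith
    have "0 \<le> trace (P ** C)" using trace_spd_mult_pos[OF P C] by simp
    thus "elbo A y \<mu> C\<^sub>0 x C \<le> max L (L + J / 2) + ln (det C) / 2"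
      using bound[OF C, of x] \<open>0 \<le> c * (norm (x - \<mu>))\<^sup>2\<close> by simp
  qed
qed

section \<open>Continuity, compactness and existence of a maximizer\<close>

lemma continuous_on_det:
  fixes f :: "'a::topological_space \<Rightarrow> real^'n^'n"
  assumes "continuous_on S f"
  shows "continuous_on S (\<lambda>x. det (f x))"
  unfolding det_def using assms by (intro continuous_intros)

lemma continuous_on_elbo:
  assumes "\<And>p. p \<in> S \<Longrightarrow> det (snd p) > 0"
  shows "continuous_on S (\<lambda>(x, C). elbo A y \<mu> C\<^sub>0 x C)"
  unfolding elbo_eq case_prod_beta trace_def matrix_matrix_mult_def matrix_vector_mult_def inner_vec_def
  by (intro continuous_intros continuous_on_det) (use assms in fastforce)+

text \<open>Strict definiteness is not a closed condition. Semidefiniteness with a lower bound on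
  the determinant is, and for \<open>e > 0\<close> it implies strict definiteness.\<close>

lemma compact_semidefinite_det_ge:
  "compact {C :: real^'n^'n. norm C \<le> r \<and> transpose C = C \<and> (\<forall>v. 0 \<le> v \<bullet> (C *v v)) \<and> e \<le> det C}"
proof -
  have "{C :: real^'n^'n. norm C \<le> r \<and> transpose C = C \<and> (\<forall>v. 0 \<le> v \<bullet> (C *v v)) \<and> e \<le> det C}
    = cball 0 r \<inter> ({C. transpose C = C} \<inter> {C. \<forall>v. 0 \<le> v \<bullet> (C *v v)} \<inter> {C. e \<le> det C})"
    by auto
  moreover have "closed {C :: real^'n^'n. transpose C = C}"
    unfolding transpose_def by (intro closed_Collect_eq continuous_intros)
  moreover have "closed {C :: real^'n^'n. \<forall>v. 0 \<le> v \<bullet> (C *v v)}"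
    unfolding matrix_vector_mult_def inner_vec_def
    by (intro closed_Collect_all closed_Collect_le continuous_intros)
  moreover have "closed {C :: real^'n^'n. e \<le> det C}"
    by (intro closed_Collect_le continuous_intros continuous_on_det)
  ultimately show ?thesis by (simp add: compact_Int_closed closed_Int)
qed

text \<open>The prior parameters \<open>(\<mu>, C\<^sub>0)\<close> serve as the reference point
  whose value fixes the superlevel set.\<close>

lemma elbo_attains_max:
  fixes A :: "real^'m^'n"
  assumes C\<^sub>0: "C\<^sub>0 \<in> spd_matrices"
  shows "\<exists>x. \<exists>C\<in>spd_matrices. \<forall>z. \<forall>D\<in>spd_matrices. elbo A y \<mu> C\<^sub>0 z D \<le> elbo A y \<mu> C\<^sub>0 x C"
proof -
  define f where "f = elbo A y \<mu> C\<^sub>0"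
  obtain b K where b: "b > 0"
    and le: "\<And>x C. C \<in> spd_matrices \<Longrightarrow> f x C \<le> K - b * (norm (x - \<mu>))\<^sup>2 - b * trace C"
    and le': "\<And>x C. C \<in> spd_matrices \<Longrightarrow> f x C \<le> K + ln (det C) / 2"
    using elbo_upper_bounds[OF C\<^sub>0, of A y \<mu>] unfolding f_def by metis
  \<comment> \<open>Solving the first upper bound at the reference value bounds squared distance
    plus trace by \<open>r\<close>; solving the second bounds the determinant below by
    \<open>e\<close>.\<close>
  define r where "r = (K - f \<mu> C\<^sub>0) / b"
  define e where "e = exp (2 * (f \<mu> C\<^sub>0 - K))"
  define S where "S = cball \<mu> (sqrt r) \<times> {C :: real^'m^'m. norm C \<le> (CARD('m))\<^sup>2 * r \<and>
    transpose C = C \<and> (\<forall>v. 0 \<le> v \<bullet> (C *v v)) \<and> e \<le> det C}"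
  have "compact S"
    unfolding S_def by (intro compact_Times compact_semidefinite_det_ge) simp
  have "e > 0" by (simp add: e_def)
  have superlevel: "(x, C) \<in> S" if C: "C \<in> spd_matrices" and "f \<mu> C\<^sub>0 \<le> f x C" for x C
  proof -
    have "trace C \<ge> 0"
      using order_trans[OF norm_ge_zero norm_le_trace_spd[OF C]] by (simp add: zero_le_mult_iff)
    have "b * (norm (x - \<mu>))\<^sup>2 + b * trace C \<le> K - f \<mu> C\<^sub>0"
      using le[OF C, of x] that(2) by linarith
    hence sum: "(norm (x - \<mu>))\<^sup>2 + trace C \<le> r"
      using b by (simp add: r_def field_simps)
    hence "norm (x - \<mu>) \<le> sqrt r"
      using \<open>trace C \<ge> 0\<close> by (intro real_le_rsqrt) simp
    moreover have "norm C \<le> (CARD('m))\<^sup>2 * r"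
    proof -
      have "trace C \<le> r" using sum zero_le_power2[of "norm (x - \<mu>)"] by linarith
      hence "(CARD('m))\<^sup>2 * trace C \<le> (CARD('m))\<^sup>2 * r" by (intro mult_left_mono) auto
      thus ?thesis using norm_le_trace_spd[OF C] by linarith
    qed
    moreover have "e \<le> det C"
    proof -
      have "2 * (f \<mu> C\<^sub>0 - K) \<le> ln (det C)"
        using le'[OF C, of x] that(2) by argo
      thus ?thesis
        unfolding e_def using det_spd_pos[OF C] by (simp add: ln_ge_iff)
    qed
    ultimately show ?thesis
      using C spd_nonneg[OF C] by (auto simp: S_def dist_norm norm_minus_commute spd_matrices_def)
  qed
  have spd: "C \<in> spd_matrices" if "(x, C) \<in> S" for x C
    using that \<open>e > 0\<close> by (intro spd_if_semidefinite) (auto simp: S_def)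
  have "(\<mu>, C\<^sub>0) \<in> S" using superlevel C\<^sub>0 by simp
  moreover have "continuous_on S (\<lambda>(x, C). f x C)"
    unfolding f_def by (rule continuous_on_elbo) (use spd det_spd_pos in force)
  ultimately obtain x C where xC: "(x, C) \<in> S"
    and max: "\<And>z D. (z, D) \<in> S \<Longrightarrow> f z D \<le> f x C"
    using continuous_attains_sup[OF \<open>compact S\<close>, of "\<lambda>(x, C). f x C"] by fastforce
  \<comment> \<open>A point outside \<open>S\<close> stays below the reference value, which the
    maximum over \<open>S\<close> already reaches.\<close>
  have "elbo A y \<mu> C\<^sub>0 z D \<le> elbo A y \<mu> C\<^sub>0 x C" if "D \<in> spd_matrices" for z D
    unfolding f_def[symmetric]
    using superlevel[OF that, of z] max[of z D] max[OF \<open>(\<mu>, C\<^sub>0) \<in> S\<close>] by linarith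
  with spd[OF xC] show ?thesis by blast
qed

theorem theorem3p2:
  fixes A :: "real^'m^'n" and y :: "nat^'n" and \<mu>\<^sub>0 :: "real^'m" and C\<^sub>0 :: "real^'m^'m"
  assumes "C\<^sub>0 \<in> spd_matrices"
  shows "\<exists>!(x, C). is_arg_max (\<lambda>(x, C). elbo A y \<mu>\<^sub>0 C\<^sub>0 x C) (\<lambda>(x, C). C \<in> spd_matrices) (x, C)"
proof -
  let ?max = "\<lambda>p. is_arg_max (\<lambda>(x, C). elbo A y \<mu>\<^sub>0 C\<^sub>0 x C) (\<lambda>(x, C). C \<in> spd_matrices) p"
  obtain x C where "C \<in> spd_matrices"
    "\<And>z D. D \<in> spd_matrices \<Longrightarrow> elbo A y \<mu>\<^sub>0 C\<^sub>0 z D \<le> elbo A y \<mu>\<^sub>0 C\<^sub>0 x C"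
    using elbo_attains_max[OF assms, of A y \<mu>\<^sub>0] by auto
  hence ex: "?max (x, C)"
    by (simp add: is_arg_max_linorder)
  have "\<exists>!p. ?max p"
  proof (rule ex_ex1I)
    show "\<exists>p. ?max p" using ex by blast
    fix p p' assume "?max p" "?max p'"
    moreover obtain x C z D where p: "p = (x, C)" "p' = (z, D)" by (metis surj_pair)
    ultimately have C: "C \<in> spd_matrices" and D: "D \<in> spd_matrices"
      and max: "\<And>w M. M \<in> spd_matrices \<Longrightarrow> elbo A y \<mu>\<^sub>0 C\<^sub>0 w M \<le> elbo A y \<mu>\<^sub>0 C\<^sub>0 x C"
        "\<And>w M. M \<in> spd_matrices \<Longrightarrow> elbo A y \<mu>\<^sub>0 C\<^sub>0 w M \<le> elbo A y \<mu>\<^sub>0 C\<^sub>0 z D"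
      by (auto simp: is_arg_max_linorder)
    have mid: "(1/2) *\<^sub>R (C + D) \<in> spd_matrices"
      using C D by (simp add: spd_scaleR spd_add)
    \<comment> \<open>If the maximizers differed, twice the value at their midpoint would exceed the
      sum of the two maxima.\<close>
    show "p = p'"
      using elbo_midpoint[OF assms C D, of x z A y \<mu>\<^sub>0] max(1)[OF mid, of "(1/2) *\<^sub>R (x + z)"]
        max(2)[OF mid, of "(1/2) *\<^sub>R (x + z)"] unfolding p by argo
  qed
  thus ?thesis by (simp add: case_prod_beta)
qed

end
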